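(* Let $\mathcal{A}\subset\mathbb{R}^n$ be a non-empty finite set and let $X=\operatorname{pos}\{v^{(1)},\ldots,v^{(k)}\}\subset\mathbb{R}^n$ be an $n$-dimensional polyhedral cone spanned by the vectors $v^{(1)},\ldots,v^{(k)}$, where $k\ge n$. Then $$\{\lambda\in\Lambda_X^\star(\mathcal{A}) : \mathcal{A}\lambda=\mathbf{0}\}=\Lambda_{\mathbb{R}^n}^\star(\mathcal{A}).$$
   Context: $\operatorname{pos}$ denotes the set of all non-negative linear combinations. $\mathbb{R}^{\mathcal{A}}$ is the set of real vectors indexed by $\mathcal{A}$. For $\beta\in\mathcal{A}$, $N_\beta=\{\nu\in\mathbb{R}^{\mathcal{A}} : \nu_\alpha\ge 0 \text{ for all }\alpha\in\mathcal{A}\setminus\{\beta\},\ \sum_{\alpha\in\mathcal{A}}\nu_\alpha=0\}$. For $\nu\in\mathbb{R}^{\mathcal{A}}$ write $\mathcal{A}\nu=\sum_{\alpha\in\mathcal{A}}\alpha\,\nu_\alpha\in\mathbb{R}^n$. For a non-empty convex set $X\subset\mathbb{R}^n$, $\sigma_X(y)=\sup\{y^Tx : x\in X\}$ is the support function. A non-zero vector $\nu^*\in N_\beta$ is an $X$-circuit (sublinear circuit of $\mathcal{A}$ with respect to $X$) if (i) $\sigma_X(-\mathcal{A}\nu^* )<\infty$, and (ii) whenever the map $\nu\mapsto\sigma_X(-\mathcal{A}\nu)$ is linear on a two-dimensional convex cone contained in $N_\beta$ (i.e. is finite there and coincides there with a linear function), $\nu^*$ is not in the relative interior of that cone. $\Lambda_X(\mathcal{A},\beta)$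 denotes the set of $X$-circuits $\lambda\in N_\beta$ with $\lambda_\beta=-1$ (normalized), and $\Lambda_X(\mathcal{A})=\bigcup_{\beta\in\mathcal{A}}\Lambda_X(\mathcal{A},\beta)$. The circuit graph is the convex cone $G_X(\mathcal{A})=\operatorname{cone}\left(\{(\lambda,\sigma_X(-\mathcal{A}\lambda)) : \lambda\in\Lambda_X(\mathcal{A})\}\cup\{(\mathbf{0},1)\}\right)\subset\mathbb{R}^{\mathcal{A}}\times\mathbb{R}$ (conic hull). An $X$-circuit $\nu$ is reduced if its extended form $(\nu,\sigma_X(-\mathcal{A}\nu))$ generates an extreme ray of $G_X(\mathcal{A})$. $\Lambda_X^\star(\mathcal{A})$ is the set of normalized reduced $X$-circuits; $\Lambda_{\mathbb{R}^n}^\star(\mathcal{A})$ is the same with $X$ replaced by $\mathbb{R}^n$. *)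

theory Defs
  imports "HOL-Analysis.Analysis"
begin

text \<open>
  A non-empty finite set of points of Euclidean space is given by an injective family \<open>a\<close> whose
  index type \<open>'i\<close> is finite, so that the set is \<open>range a\<close>. The space of real vectors indexed by
  the set is then \<open>real ^ 'i\<close>, and an index \<open>\<beta> :: 'i\<close> stands for the point \<open>a \<beta>\<close>.
\<close>

definition pos :: "'a::real_vector set \<Rightarrow> 'a set" where
  "pos S = {\<Sum>x\<in>T. c x *\<^sub>R x | T c. finite T \<and> T \<subseteq> S \<and> (\<forall>x\<in>T. 0 \<le> c x)}"

definition point_sum :: "('i::finite \<Rightarrow> real ^ 'n) \<Rightarrow> real ^ 'i \<Rightarrow> real ^ 'n" where
  "point_sum a \<nu> = (\<Sum>\<alpha>\<in>UNIV. \<nu> $ \<alpha> *\<^sub>R a \<alpha>)"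

definition support_fun :: "(real ^ 'n) set \<Rightarrow> real ^ 'n \<Rightarrow> ereal" where
  "support_fun X y = (SUP x\<in>X. ereal (y \<bullet> x))"

definition N_cone :: "'i::finite \<Rightarrow> (real ^ 'i) set" where
  "N_cone \<beta> = {\<nu>. (\<forall>\<alpha>. \<alpha> \<noteq> \<beta> \<longrightarrow> 0 \<le> \<nu> $ \<alpha>) \<and> (\<Sum>\<alpha>\<in>UNIV. \<nu> $ \<alpha>) = 0}"

definition support_linear_on ::
  "(real ^ 'n) set \<Rightarrow> ('i::finite \<Rightarrow> real ^ 'n) \<Rightarrow> (real ^ 'i) set \<Rightarrow> bool" where
  "support_linear_on X a C \<longleftrightarrow>
     (\<exists>L :: real ^ 'i \<Rightarrow> real. linear L \<and>
        (\<forall>\<nu>\<in>C. support_fun X (- point_sum a \<nu>) = ereal (L \<nu>)))"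

definition X_circuit ::
  "(real ^ 'n) set \<Rightarrow> ('i::finite \<Rightarrow> real ^ 'n) \<Rightarrow> 'i \<Rightarrow> real ^ 'i \<Rightarrow> bool" where
  "X_circuit X a \<beta> \<nu> \<longleftrightarrow>
     \<nu> \<in> N_cone \<beta> \<and> \<nu> \<noteq> 0 \<and>
     support_fun X (- point_sum a \<nu>) < \<infinity> \<and>
     (\<forall>C. convex_cone C \<and> aff_dim C = 2 \<and> C \<subseteq> N_cone \<beta> \<and> support_linear_on X a C
        \<longrightarrow> \<nu> \<notin> rel_interior C)"

definition circuits_at ::
  "(real ^ 'n) set \<Rightarrow> ('i::finite \<Rightarrow> real ^ 'n) \<Rightarrow> 'i \<Rightarrow> (real ^ 'i) set" where
  "circuits_at X a \<beta> = {\<nu>. X_circuit X a \<beta> \<nu> \<and> \<nu> $ \<beta> = -1}"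

definition circuits ::
  "(real ^ 'n) set \<Rightarrow> ('i::finite \<Rightarrow> real ^ 'n) \<Rightarrow> (real ^ 'i) set" where
  "circuits X a = (\<Union>\<beta>. circuits_at X a \<beta>)"

text \<open>
  For non-empty \<open>X\<close> the support function is finite at every circuit, so \<^const>\<open>real_of_ereal\<close> loses
  nothing there.
\<close>

definition extended_form ::
  "(real ^ 'n) set \<Rightarrow> ('i::finite \<Rightarrow> real ^ 'n) \<Rightarrow> real ^ 'i \<Rightarrow> (real ^ 'i) \<times> real" where
  "extended_form X a \<nu> = (\<nu>, real_of_ereal (support_fun X (- point_sum a \<nu>)))"

definition circuit_graph ::
  "(real ^ 'n) set \<Rightarrow> ('i::finite \<Rightarrow> real ^ 'n) \<Rightarrow> ((real ^ 'i) \<times> real) set" where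
  "circuit_graph X a = convex_cone hull (extended_form X a ` circuits X a \<union> {(0, 1)})"

text \<open>An extreme ray of a convex cone is a face that is a ray.\<close>

definition generates_extreme_ray :: "'a::real_vector \<Rightarrow> 'a set \<Rightarrow> bool" where
  "generates_extreme_ray v G \<longleftrightarrow> v \<noteq> 0 \<and> (conic hull {v}) face_of G"

definition reduced_circuit ::
  "(real ^ 'n) set \<Rightarrow> ('i::finite \<Rightarrow> real ^ 'n) \<Rightarrow> real ^ 'i \<Rightarrow> bool" where
  "reduced_circuit X a \<nu> \<longleftrightarrow>
     (\<exists>\<beta>. X_circuit X a \<beta> \<nu>) \<and> generates_extreme_ray (extended_form X a \<nu>) (circuit_graph X a)"

definition reduced_circuits ::
  "(real ^ 'n) set \<Rightarrow> ('i::finite \<Rightarrow> real ^ 'n) \<Rightarrow> (real ^ 'i) set" where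
  "reduced_circuits X a = {\<nu> \<in> circuits X a. reduced_circuit X a \<nu>}"

end

theory Submission
  imports Defs
begin

text \<open>
  For a cone \<open>X\<close> the support function only takes the values \<open>0\<close> and \<open>\<infinity>\<close>, and it is finite at
  \<open>- point_sum a \<nu>\<close> iff \<open>point_sum a \<nu>\<close> lies in the dual cone of \<open>X\<close>. As \<open>X\<close> spans the space, its
  dual cone is pointed, so \<open>0\<close> is a face of it. Pulled back along \<open>point_sum a\<close>, this says that the
  circuits for the whole space are the \<open>X\<close>-circuits \<open>\<nu>\<close> with \<open>point_sum a \<nu> = 0\<close>, and that the
  circuit graph of the whole space is a face of that of \<open>X\<close>. The extreme rays of a face are the
  extreme rays of the cone that lie in the face.
\<close>

section \<open>The dual cone and its pointedness\<close>

definition dual_cone :: "'a::real_inner set \<Rightarrow> 'a set" where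
  "dual_cone X = {y. \<forall>x\<in>X. 0 \<le> y \<bullet> x}"

lemma dual_cone_0 [simp]: "0 \<in> dual_cone X"
  by (simp add: dual_cone_def)

lemma dual_cone_add: "y \<in> dual_cone X \<Longrightarrow> z \<in> dual_cone X \<Longrightarrow> y + z \<in> dual_cone X"
  by (simp add: dual_cone_def inner_left_distrib)

lemma dual_cone_scaleR: "y \<in> dual_cone X \<Longrightarrow> 0 \<le> c \<Longrightarrow> c *\<^sub>R y \<in> dual_cone X"
  by (simp add: dual_cone_def)

text \<open>Such a \<open>y\<close> is orthogonal to all of \<open>X\<close>, hence to its span, and
  so to itself.\<close>

lemma dual_cone_pointed:
  assumes "span X = UNIV" "y \<in> dual_cone X" "- y \<in> dual_cone X"
  shows "y = 0"
proof -
  have "orthogonal y x" if "x \<in> X" for x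
    using assms(2,3) that by (force simp: dual_cone_def orthogonal_def)
  then have "orthogonal y y"
    using assms(1) by (intro orthogonal_to_span[of y X]) auto
  then show ?thesis
    by (simp add: orthogonal_def)
qed

text \<open>This is the form in which 0 being a face of the dual cone is applied each time a
  vanishing \<open>point_sum\<close> splits into two summands.\<close>

lemma dual_cone_add_eq_0:
  assumes "span X = UNIV" "y \<in> dual_cone X" "z \<in> dual_cone X" "y + z = 0"
  shows "y = 0" "z = 0"
proof -
  have "- y = z"
    using assms(4) by (rule minus_unique)
  then show "y = 0"
    using dual_cone_pointed[of X y] assms(1-3) by simp
  then show "z = 0"
    using assms(4) by simp
qed

section \<open>Support functions of cones\<close>

lemma conic_pos: "conic (pos S)"
proof -
  have "c *\<^sub>R (\<Sum>x\<in>T. b x *\<^sub>R x) \<in> pos S"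
    if "finite T" "T \<subseteq> S" "\<forall>x\<in>T. 0 \<le> b x" "0 \<le> c" for c T and b :: "'a \<Rightarrow> real"
  proof -
    have "c *\<^sub>R (\<Sum>x\<in>T. b x *\<^sub>R x) = (\<Sum>x\<in>T. (c * b x) *\<^sub>R x)"
      by (simp add: scaleR_sum_right)
    moreover have "\<forall>x\<in>T. 0 \<le> c * b x"
      using that by simp
    ultimately show ?thesis
      using that(1,2) unfolding pos_def by (auto intro!: exI[of _ T] exI[of _ "\<lambda>x. c * b x"])
  qed
  then show ?thesis
    by (fastforce simp: conic_def pos_def[of S])
qed

lemma zero_in_pos: "0 \<in> pos S"
  unfolding pos_def by (auto intro!: exI[of _ "{}"])

lemma span_full_aff_dim:
  fixes X :: "'a::euclidean_space set"
  assumes "aff_dim X = int DIM('a)"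
  shows "span X = UNIV"
  using assms affine_hull_subset_span[of X] by (auto simp: aff_dim_eq_full)

lemma support_fun_cone_eq_0:
  assumes "0 \<in> X" "- y \<in> dual_cone X"
  shows "support_fun X y = 0"
  unfolding support_fun_def
proof (rule antisym)
  show "(SUP x\<in>X. ereal (y \<bullet> x)) \<le> 0"
    using assms(2) by (intro SUP_least) (auto simp: dual_cone_def)
  show "0 \<le> (SUP x\<in>X. ereal (y \<bullet> x))"
    using assms(1) by (intro SUP_upper2[of 0]) auto
qed

lemma support_fun_cone_finite_iff:
  assumes "conic X" "0 \<in> X"
  shows "support_fun X y < \<infinity> \<longleftrightarrow> - y \<in> dual_cone X"
proof
  assume fin: "support_fun X y < \<infinity>"
  show "- y \<in> dual_cone X"
  proof (rule ccontr)
    assume "- y \<notin> dual_cone X"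
    then obtain x where x: "x \<in> X" "0 < y \<bullet> x"
      by (auto simp: dual_cone_def not_le)
    have "ereal r \<le> support_fun X y" for r
    proof -
      \<comment> \<open>Scaling \<open>x\<close> by this factor makes the inner product with
        \<open>y\<close> equal to \<open>\<bar>r\<bar>\<close>, so the supremum exceeds every
        real.\<close>
      define c where "c = \<bar>r\<bar> / (y \<bullet> x)"
      have "c *\<^sub>R x \<in> X"
        using assms(1) x by (auto simp: conic_def c_def)
      then have "ereal (y \<bullet> (c *\<^sub>R x)) \<le> support_fun X y"
        unfolding support_fun_def by (intro SUP_upper)
      moreover have "r \<le> y \<bullet> (c *\<^sub>R x)"
        using x(2) by (simp add: c_def)
      ultimately show ?thesis
        by (meson ereal_less_eq(3) order_trans)
    qed
    then have "support_fun X y = \<infinity>"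
      by (intro ereal_top)
    then show False
      using fin by simp
  qed
qed (use assms(2) support_fun_cone_eq_0 in fastforce)

section \<open>Circuits of a cone and of the whole space\<close>

lemma point_sum_add: "point_sum a (\<mu> + \<nu>) = point_sum a \<mu> + point_sum a \<nu>"
  by (simp add: point_sum_def scaleR_left_distrib sum.distrib)

lemma point_sum_scaleR: "point_sum a (c *\<^sub>R \<nu>) = c *\<^sub>R point_sum a \<nu>"
  by (simp add: point_sum_def scaleR_sum_right)

lemma point_sum_0 [simp]: "point_sum a 0 = 0"
  by (simp add: point_sum_def)

text \<open>Where the support function of a cone is finite it is 0, so finiteness on
  \<open>C\<close> already gives linearity, with \<open>L = 0\<close>.\<close>

lemma support_linear_on_cone_iff:
  assumes "conic X" "0 \<in> X"
  shows "support_linear_on X a C \<longleftrightarrow> (\<forall>\<nu>\<in>C. point_sum a \<nu> \<in> dual_cone X)"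
proof
  assume "support_linear_on X a C"
  then have "\<forall>\<nu>\<in>C. support_fun X (- point_sum a \<nu>) < \<infinity>"
    by (auto simp: support_linear_on_def)
  then show "\<forall>\<nu>\<in>C. point_sum a \<nu> \<in> dual_cone X"
    by (simp only: support_fun_cone_finite_iff[OF assms] minus_minus)
next
  assume "\<forall>\<nu>\<in>C. point_sum a \<nu> \<in> dual_cone X"
  then have "\<forall>\<nu>\<in>C. support_fun X (- point_sum a \<nu>) = ereal 0"
    using support_fun_cone_eq_0[OF assms(2)] by (auto simp: zero_ereal_def)
  then show "support_linear_on X a C"
    unfolding support_linear_on_def by (intro exI[of _ "\<lambda>_. 0"]) (auto intro: linearI)
qed

text \<open>The whole space is itself a cone, so the characterisations above apply to it as well;
  there they reduce to \<open>point_sum a \<nu> = 0\<close>.\<close>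

lemma dual_cone_UNIV: "dual_cone UNIV = {0 :: 'a::real_inner}"
proof -
  have "y = 0" if "y \<in> dual_cone UNIV" for y :: 'a
  proof -
    have "0 \<le> y \<bullet> (- y)"
      using that unfolding dual_cone_def by blast
    then have "y \<bullet> y = 0"
      using inner_ge_zero[of y] unfolding inner_minus_right by linarith
    then show ?thesis
      by simp
  qed
  then show ?thesis
    by auto
qed

text \<open>The segment from \<open>\<mu>\<close> to \<open>\<nu>\<close> can be prolonged beyond
  \<open>\<nu>\<close> within \<open>C\<close>. Its new endpoint is mapped to a negative multiple of
  \<open>point_sum a \<mu>\<close>, and pointedness forces that to vanish.\<close>

lemma point_sum_eq_0_on_cone:
  assumes "span X = UNIV" "convex C" "\<forall>\<nu>\<in>C. point_sum a \<nu> \<in> dual_cone X"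
    and "\<nu> \<in> rel_interior C" "point_sum a \<nu> = 0" "\<mu> \<in> C"
  shows "point_sum a \<mu> = 0"
proof -
  obtain e where e: "e > 1" "(1 - e) *\<^sub>R \<mu> + e *\<^sub>R \<nu> \<in> C"
    using convex_rel_interior_if2[OF assms(2,4)] hull_inc[OF assms(6)] by blast
  have "point_sum a ((1 - e) *\<^sub>R \<mu> + e *\<^sub>R \<nu>) = (1 - e) *\<^sub>R point_sum a \<mu>"
    using assms(5) by (simp only: point_sum_add point_sum_scaleR) simp
  then have "(1 - e) *\<^sub>R point_sum a \<mu> \<in> dual_cone X"
    using e(2) assms(3) by metis
  moreover have "(e - 1) *\<^sub>R point_sum a \<mu> \<in> dual_cone X"
    using e(1) assms(3,6) by (intro dual_cone_scaleR) auto
  moreover have "(1 - e) *\<^sub>R point_sum a \<mu> + (e - 1) *\<^sub>R point_sum a \<mu> = 0"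
    by (simp flip: scaleR_left_distrib)
  ultimately have "(1 - e) *\<^sub>R point_sum a \<mu> = 0"
    by (rule dual_cone_add_eq_0(1)[OF assms(1)])
  then show ?thesis
    using e(1) by simp
qed

text \<open>For \<open>\<nu>\<close> in the kernel of \<open>point_sum a\<close>, both circuit
  notions are tested by the same cones \<open>C\<close>: by the preceding lemma, a cone that is
  admissible for \<open>X\<close> and has \<open>\<nu>\<close> in its relative interior lies in the
  kernel, and cones in the kernel are admissible for both.\<close>

lemma X_circuit_UNIV_iff:
  assumes "conic X" "0 \<in> X" "span X = UNIV"
  shows "X_circuit UNIV a \<beta> \<nu> \<longleftrightarrow> X_circuit X a \<beta> \<nu> \<and> point_sum a \<nu> = 0"
proof -
  note iffs = support_linear_on_cone_iff[OF assms(1,2)] support_fun_cone_finite_iff[OF assms(1,2)]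
    support_linear_on_cone_iff[OF conic_UNIV UNIV_I] support_fun_cone_finite_iff[OF conic_UNIV UNIV_I]
  have "\<forall>\<mu>\<in>C. point_sum a \<mu> = 0"
    if "point_sum a \<nu> = 0" "convex_cone C" "\<forall>\<mu>\<in>C. point_sum a \<mu> \<in> dual_cone X"
      "\<nu> \<in> rel_interior C" for C
    using point_sum_eq_0_on_cone[OF assms(3) _ that(3,4,1)] that(2) by (auto simp: convex_cone_def)
  then show ?thesis
    unfolding X_circuit_def iffs minus_minus dual_cone_UNIV singleton_iff
    by (smt (verit) dual_cone_0)
qed

lemma circuits_UNIV:
  assumes "conic X" "0 \<in> X" "span X = UNIV"
  shows "circuits UNIV a = {\<nu> \<in> circuits X a. point_sum a \<nu> = 0}"
  by (auto simp: circuits_def circuits_at_def X_circuit_UNIV_iff[OF assms])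

section \<open>The two circuit graphs\<close>

lemma extended_form_kernel:
  assumes "0 \<in> X" "point_sum a \<nu> = 0"
  shows "extended_form X a \<nu> = (\<nu>, 0)"
  using assms by (simp add: extended_form_def support_fun_cone_eq_0)

lemma circuit_graph_kernel:
  assumes "conic X" "0 \<in> X" "span X = UNIV" "g \<in> circuit_graph X a"
  shows "point_sum a (fst g) \<in> dual_cone X"
    and "point_sum a (fst g) = 0 \<Longrightarrow> g \<in> circuit_graph UNIV a"
proof -
  \<comment> \<open>Both claims are proved at once by showing that \<open>H\<close> is a convex cone
    containing the generators. Closure under addition in the second claim relies on the first: if
    the image of a sum vanishes, so do both images.\<close>
  define H where "H = {g. point_sum a (fst g) \<in> dual_cone X \<and>
    (point_sum a (fst g) = 0 \<longrightarrow> g \<in> circuit_graph UNIV a)}"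
  have U: "convex_cone (circuit_graph UNIV a)"
    unfolding circuit_graph_def by (rule convex_cone_convex_cone_hull)
  have "convex_cone H"
    unfolding convex_cone_iff
  proof (intro conjI ballI allI impI)
    show "0 \<in> H"
      using convex_cone_contains_0[OF U] by (simp add: H_def)
  next
    fix g h assume "g \<in> H" "h \<in> H"
    then show "g + h \<in> H"
      using dual_cone_add_eq_0[OF assms(3), of "point_sum a (fst g)" "point_sum a (fst h)"]
      by (simp add: H_def point_sum_add dual_cone_add convex_cone_add[OF U])
  next
    fix g and c :: real assume "g \<in> H" "0 \<le> c"
    then show "c *\<^sub>R g \<in> H"
      using convex_cone_contains_0[OF U] convex_cone_scaleR[OF U]
      \<comment> \<open>For \<open>c = 0\<close> the image of the multiple vanishes even if that of
        \<open>g\<close> does not; the multiple is then the apex.\<close>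
      by (cases "c = 0") (auto simp: H_def point_sum_scaleR dual_cone_scaleR)
  qed
  moreover have "extended_form X a ` circuits X a \<union> {(0, 1)} \<subseteq> H"
  proof -
    have "extended_form X a \<nu> \<in> H" if \<nu>: "\<nu> \<in> circuits X a" for \<nu>
    proof -
      have "point_sum a \<nu> \<in> dual_cone X"
        using \<nu> support_fun_cone_finite_iff[OF assms(1,2)]
        by (fastforce simp: circuits_def circuits_at_def X_circuit_def)
      moreover have "extended_form X a \<nu> \<in> circuit_graph UNIV a" if z: "point_sum a \<nu> = 0"
      proof -
        have "extended_form X a \<nu> = extended_form UNIV a \<nu>"
          using extended_form_kernel[OF _ z] assms(2) by simp
        moreover have "\<nu> \<in> circuits UNIV a"
          using \<nu> z by (simp add: circuits_UNIV[OF assms(1-3)])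
        ultimately show ?thesis
          unfolding circuit_graph_def by (auto intro: hull_inc)
      qed
      ultimately show ?thesis
        by (simp add: H_def extended_form_def)
    qed
    moreover have "(0, 1) \<in> H"
      by (auto simp: H_def circuit_graph_def intro: hull_inc)
    ultimately show ?thesis by auto
  qed
  ultimately have "circuit_graph X a \<subseteq> H"
    unfolding circuit_graph_def by (intro hull_minimal)
  then show "point_sum a (fst g) \<in> dual_cone X"
    and "point_sum a (fst g) = 0 \<Longrightarrow> g \<in> circuit_graph UNIV a"
    using assms(4) by (auto simp: H_def)
qed

lemma circuit_graph_UNIV_subset:
  assumes "conic X" "0 \<in> X" "span X = UNIV"
  shows "circuit_graph UNIV a \<subseteq> circuit_graph X a"
proof -
  have "extended_form UNIV a ` circuits UNIV a \<subseteq> extended_form X a ` circuits X a"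
    using assms(2) by (force simp: circuits_UNIV[OF assms] extended_form_kernel)
  then show ?thesis
    unfolding circuit_graph_def by (intro hull_mono) auto
qed

text \<open>A point of an open segment has positive weights on both endpoints, so if its image is 0,
  the images of the endpoints, lying in the pointed dual cone, are 0 too.\<close>

lemma circuit_graph_UNIV_face:
  assumes "conic X" "0 \<in> X" "span X = UNIV"
  shows "circuit_graph UNIV a face_of circuit_graph X a"
  unfolding face_of_def
proof (intro conjI ballI impI)
  show "circuit_graph UNIV a \<subseteq> circuit_graph X a"
    by (rule circuit_graph_UNIV_subset[OF assms])
  show "convex (circuit_graph UNIV a)"
    unfolding circuit_graph_def by (rule convex_convex_cone_hull)
  fix g h p
  assume gh: "g \<in> circuit_graph X a" "h \<in> circuit_graph X a"
    and p: "p \<in> circuit_graph UNIV a" "p \<in> open_segment g h"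
  let ?A = "\<lambda>q. point_sum a (fst q)"
  have dual: "?A g \<in> dual_cone X" "?A h \<in> dual_cone X"
    by (intro circuit_graph_kernel(1)[OF assms] gh)+
  obtain u where u: "0 < u" "u < 1" "p = (1 - u) *\<^sub>R g + u *\<^sub>R h"
    using p(2) by (auto simp: in_segment)
  have "?A p = 0"
    \<comment> \<open>The lemma is applied with the whole space as the cone, whose dual cone is
      0.\<close>
    using circuit_graph_kernel(1)[OF conic_UNIV UNIV_I span_UNIV p(1)] by (simp add: dual_cone_UNIV)
  then have "(1 - u) *\<^sub>R ?A g + u *\<^sub>R ?A h = 0"
    by (simp add: u(3) point_sum_add point_sum_scaleR)
  then have "(1 - u) *\<^sub>R ?A g = 0" "u *\<^sub>R ?A h = 0"
    using dual_cone_add_eq_0[OF assms(3)] dual u(1,2) by (meson dual_cone_scaleR diff_ge_0_iff_ge less_imp_le)+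
  then show "g \<in> circuit_graph UNIV a" "h \<in> circuit_graph UNIV a"
    using circuit_graph_kernel(2)[OF assms gh(1)] circuit_graph_kernel(2)[OF assms gh(2)] u(1,2)
    by auto
qed

lemma reduced_circuits_UNIV:
  assumes "conic X" "0 \<in> X" "span X = UNIV"
  shows "reduced_circuits UNIV a = {\<nu> \<in> reduced_circuits X a. point_sum a \<nu> = 0}"
proof -
  have "generates_extreme_ray (extended_form UNIV a \<nu>) (circuit_graph UNIV a) \<longleftrightarrow>
      generates_extreme_ray (extended_form X a \<nu>) (circuit_graph X a)"
    if \<nu>: "\<nu> \<in> circuits UNIV a" for \<nu>
  proof -
    have z: "point_sum a \<nu> = 0"
      using \<nu> by (simp add: circuits_UNIV[OF assms])
    have eq: "extended_form X a \<nu> = extended_form UNIV a \<nu>"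
      using extended_form_kernel[OF _ z] assms(2) by simp
    have "extended_form UNIV a \<nu> \<in> circuit_graph UNIV a"
      unfolding circuit_graph_def using \<nu> by (auto intro: hull_inc)
    moreover have "conic (circuit_graph UNIV a)"
      unfolding circuit_graph_def by (rule conic_convex_cone_hull)
    ultimately have "conic hull {extended_form UNIV a \<nu>} \<subseteq> circuit_graph UNIV a"
      by (intro hull_minimal) auto
    \<comment> \<open>The ray lies in the smaller graph, which is a face of the larger one; hence it
      is a face of either graph iff it is a face of the other.\<close>
    then show ?thesis
      unfolding generates_extreme_ray_def eq
      using face_of_face[OF circuit_graph_UNIV_face[OF assms]] by blast
  qed
  moreover have "(\<exists>\<beta>. X_circuit Y a \<beta> \<nu>)" if "\<nu> \<in> circuits Y a" for Y \<nu>
    using that by (auto simp: circuits_def circuits_at_def)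
  ultimately show ?thesis
    unfolding reduced_circuits_def reduced_circuit_def by (auto simp: circuits_UNIV[OF assms])
qed

theorem theorem6p4:
  fixes a :: "'i::finite \<Rightarrow> real ^ 'n"
    and v :: "nat \<Rightarrow> real ^ 'n"
    and k :: nat
    and X :: "(real ^ 'n) set"
  assumes "inj a"
    and "k \<ge> CARD('n)"
    and "X = pos (v ` {1..k})"
    and "aff_dim X = int CARD('n)"
  shows "{\<nu> \<in> reduced_circuits X a. point_sum a \<nu> = 0} = reduced_circuits UNIV a"
proof -
  \<comment> \<open>Full dimension makes the affine hull, and with it the span, the whole
    space.\<close>
  have "conic X" "0 \<in> X" "span X = UNIV"
    using assms(3,4) conic_pos zero_in_pos span_full_aff_dim[of X] by auto
  then show ?thesis
    by (rule reduced_circuits_UNIV[symmetric])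
qed

end
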